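(* Let $G$ be a cograph. Then every clique partition $\mathcal{X}$ of $G$ that can be output by the algorithm \textsc{Greedy} on input $G$ is maximal under the relation $\preceq$ among all clique partitions of $G$; that is, there is no clique partition $\mathcal{Y}$ of $G$ with $\mathcal{X}\preceq\mathcal{Y}$ and $\mathcal{Y}\not\preceq\mathcal{X}$.
   Context: All graphs are finite, simple, undirected. A cograph is a graph with no induced subgraph isomorphic to the 4-vertex path $P_4$. A clique partition of $G$ is a partition of $V(G)$ into cliques (sets of pairwise adjacent vertices). The algorithm \textsc{Greedy} on input $G$: set $\mathcal{X}=\emptyset$; while $G$ has a vertex, choose any maximum-size clique $X$ of $G$, add $X$ to $\mathcal{X}$, and replace $G$ by $G-X$; output $\mathcal{X}$. For clique partitions $\mathcal{X}=\{X_1,\dots,X_s\}$ and $\mathcal{Y}=\{Y_1,\dots,Y_t\}$ of $G$ indexed so that $|X_1|\geq\dots\geq|X_s|$ and $|Y_1|\geq\dots\geq|Y_t|$ (and with $|X_i|=0$ for $i>s$, $|Y_i|=0$ for $i>t$), write $\mathcal{X}\preceq\mathcal{Y}$ if $\sum_{i=1}^{j}|X_i|\leq\sum_{i=1}^{j}|Y_i|$ for all $1\leq j\leq\max\{s,t\}$. *)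

theory Defs
  imports Main "HOL-Library.Ramsey" "HOL-Library.Disjoint_Sets" "HOL-Library.Multiset"
begin

text \<open>
  A graph is given by a vertex set \<open>V\<close> and a set \<open>E\<close> of two-element subsets of \<open>V\<close>.
  Cliques are \<^const>\<open>clique\<close> from the Ramsey theory: pairwise adjacent vertices, not
  necessarily inclusion-maximal.
\<close>

definition fin_graph :: "'a set \<Rightarrow> 'a set set \<Rightarrow> bool" where
  "fin_graph V E \<longleftrightarrow> finite V \<and> E \<subseteq> nsets V 2"

definition induced_edges :: "'a set set \<Rightarrow> 'a set \<Rightarrow> 'a set set" where
  "induced_edges E S = {e \<in> E. e \<subseteq> S}"

definition graph_iso :: "'a set \<Rightarrow> 'a set set \<Rightarrow> 'b set \<Rightarrow> 'b set set \<Rightarrow> bool" where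
  "graph_iso V E W F \<longleftrightarrow>
     (\<exists>f. bij_betw f V W \<and> (\<forall>u\<in>V. \<forall>v\<in>V. {u, v} \<in> E \<longleftrightarrow> {f u, f v} \<in> F))"

definition P4_verts :: "nat set" where
  "P4_verts = {0, 1, 2, 3}"

definition P4_edges :: "nat set set" where
  "P4_edges = {{0, 1}, {1, 2}, {2, 3}}"

definition cograph :: "'a set \<Rightarrow> 'a set set \<Rightarrow> bool" where
  "cograph V E \<longleftrightarrow> fin_graph V E \<and>
     \<not> (\<exists>S\<subseteq>V. graph_iso S (induced_edges E S) P4_verts P4_edges)"

definition clique_partition :: "'a set \<Rightarrow> 'a set set \<Rightarrow> 'a set set \<Rightarrow> bool" where
  "clique_partition V E P \<longleftrightarrow> partition_on V P \<and> (\<forall>X\<in>P. clique X E)"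

definition maximum_clique :: "'a set \<Rightarrow> 'a set set \<Rightarrow> 'a set \<Rightarrow> bool" where
  "maximum_clique V E X \<longleftrightarrow>
     X \<subseteq> V \<and> clique X E \<and> (\<forall>Y. Y \<subseteq> V \<and> clique Y E \<longrightarrow> card Y \<le> card X)"

text \<open>
  \<open>greedy_run V E A P\<close>: the loop, entered with current graph \<open>(V, E)\<close> and current family \<open>A\<close>
  of cliques, can terminate with the family \<open>P\<close>.  The choice of the maximum-size clique is
  nondeterministic.
\<close>

inductive greedy_run :: "'a set \<Rightarrow> 'a set set \<Rightarrow> 'a set set \<Rightarrow> 'a set set \<Rightarrow> bool" where
  stop: "greedy_run {} E A A"
| step: "\<lbrakk>V \<noteq> {}; maximum_clique V E X;
          greedy_run (V - X) (induced_edges E (V - X)) (insert X A) P\<rbrakk>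
         \<Longrightarrow> greedy_run V E A P"

definition greedy_output :: "'a set \<Rightarrow> 'a set set \<Rightarrow> 'a set set \<Rightarrow> bool" where
  "greedy_output V E P \<longleftrightarrow> greedy_run V E {} P"

definition sizes :: "'a set set \<Rightarrow> nat list" where
  "sizes P = rev (sorted_list_of_multiset (image_mset card (mset_set P)))"

lemma sizes_eq:
  assumes "distinct Xs" "sorted_wrt (\<ge>) (map card Xs)"
  shows "sizes (set Xs) = map card Xs"
proof -
  have s: "sorted (rev (map card Xs))"
    using assms(2) by (simp only: sorted_wrt_rev)
  have "image_mset card (mset_set (set Xs)) = mset (rev (map card Xs))"
    using assms(1) by (simp add: mset_set_set)
  then have "sizes (set Xs) = rev (sort (rev (map card Xs)))"
    by (simp only: sizes_def sorted_list_of_multiset_mset)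
  also have "\<dots> = map card Xs"
    using s by (simp only: sorted_sort_id rev_rev_ident)
  finally show ?thesis .
qed

text \<open>The \<open>i\<close>-th largest size, counted from 1 and padded with zeros.\<close>

definition part_size :: "'a set set \<Rightarrow> nat \<Rightarrow> nat" where
  "part_size P i = (if 1 \<le> i \<and> i \<le> card P then sizes P ! (i - 1) else 0)"

definition partition_le :: "'a set set \<Rightarrow> 'a set set \<Rightarrow> bool"  (infix \<open>\<preceq>\<close> 50) where
  "P \<preceq> Q \<longleftrightarrow>
     (\<forall>j. 1 \<le> j \<and> j \<le> max (card P) (card Q) \<longrightarrow>
        (\<Sum>i = 1..j. part_size P i) \<le> (\<Sum>i = 1..j. part_size Q i))"

end

theory Submission
  imports Defs "HOL-Library.Multiset_Order"
begin

text \<open>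
  For non-increasing sequences of positive sizes, \<open>\<preceq>\<close> implies the lexicographic order, which is
  the order on multisets of sizes.  So it suffices that a greedy output has the largest multiset of
  sizes among all clique partitions.  By induction on the run this reduces to an exchange property:
  for a maximum clique \<open>X\<close>, every clique partition can be turned into one that contains \<open>X\<close>
  without decreasing the multiset of sizes.  The exchange property is proved by induction over the
  decomposition of a cograph into unions and joins.  In a union one side is exchanged.  In a join
  both sides are exchanged, and the parts of the two sides are then paired up by rank.
\<close>

section \<open>Disconnection of graphs without induced paths on four vertices\<close>

text \<open>Stated for an arbitrary relation, so that a graph and its complement fall under the same
  lemmas; \<open>distinct\<close> keeps the diagonal of the relation out of play.\<close>

definition P4_free :: "('a \<Rightarrow> 'a \<Rightarrow> bool) \<Rightarrow> 'a set \<Rightarrow> bool" where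
  "P4_free R V \<longleftrightarrow> (\<forall>a\<in>V. \<forall>b\<in>V. \<forall>c\<in>V. \<forall>d\<in>V. distinct [a, b, c, d] \<longrightarrow>
     \<not> (R a b \<and> R b c \<and> R c d \<and> \<not> R a c \<and> \<not> R a d \<and> \<not> R b d))"

text \<open>For the negated relation this says that \<open>V\<close> is the join of \<open>A\<close>
  and \<open>B\<close>.\<close>

definition disconnected :: "('a \<Rightarrow> 'a \<Rightarrow> bool) \<Rightarrow> 'a set \<Rightarrow> bool" where
  "disconnected R V \<longleftrightarrow> (\<exists>A B. A \<union> B = V \<and> A \<inter> B = {} \<and> A \<noteq> {} \<and> B \<noteq> {} \<and>
     (\<forall>x\<in>A. \<forall>y\<in>B. \<not> R x y))"

lemma P4_free_subset: "P4_free R V \<Longrightarrow> W \<subseteq> V \<Longrightarrow> P4_free R W"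
  unfolding P4_free_def by blast

text \<open>The path on four vertices is self-complementary: an induced path
  \<open>a, b, c, d\<close> of the complement is an induced path \<open>b, d, a, c\<close> of
  \<open>R\<close>.\<close>

lemma P4_free_complement:
  assumes "symp R" "P4_free R V"
  shows "P4_free (\<lambda>x y. \<not> R x y) V"
  unfolding P4_free_def
proof (intro ballI impI notI)
  fix a b c d
  assume m: "a \<in> V" "b \<in> V" "c \<in> V" "d \<in> V" and dist: "distinct [a, b, c, d]"
    and p: "\<not> R a b \<and> \<not> R b c \<and> \<not> R c d \<and> \<not> \<not> R a c \<and> \<not> \<not> R a d \<and> \<not> \<not> R b d"
  have "distinct [b, d, a, c]" using dist by auto
  moreover have "R b d \<and> R d a \<and> R a c \<and> \<not> R b a \<and> \<not> R b c \<and> \<not> R d c"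
    using p assms(1) by (meson sympD)
  ultimately show False
    using m assms(2) unfolding P4_free_def by blast
qed

text \<open>A vertex \<open>v\<close> adjacent to all others is isolated in the complement.
  Otherwise, if \<open>V\<close> were connected, an induced path on four vertices would run from the
  side \<open>A\<close> of a non-neighbour of \<open>v\<close> through \<open>v\<close> into the
  other side \<open>B\<close>.\<close>

lemma disconnected_insert:
  assumes R: "symp R" "P4_free R V" and v: "v \<in> V" and dis: "disconnected R (V - {v})"
  shows "disconnected R V \<or> disconnected (\<lambda>x y. \<not> R x y) V"
proof (cases "\<forall>w\<in>V - {v}. R v w")
  case True
  have "V - {v} \<noteq> {}" using dis unfolding disconnected_def by auto
  then have "disconnected (\<lambda>x y. \<not> R x y) V"
    unfolding disconnected_def using True v
    by (intro exI[of _ "{v}"] exI[of _ "V - {v}"]) auto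
  then show ?thesis ..
next
  case False
  then obtain w where w: "w \<in> V - {v}" "\<not> R v w" by auto
  obtain A B where AB: "A \<union> B = V - {v}" "A \<inter> B = {}" "B \<noteq> {}" "w \<in> A"
    "\<forall>x\<in>A. \<forall>y\<in>B. \<not> R x y"
  proof -
    obtain A B where *: "A \<union> B = V - {v}" "A \<inter> B = {}" "A \<noteq> {}" "B \<noteq> {}"
      "\<forall>x\<in>A. \<forall>y\<in>B. \<not> R x y"
      using dis unfolding disconnected_def by blast
    show ?thesis
    proof (cases "w \<in> A")
      case True
      then show ?thesis using that * by blast
    next
      case False
      then have "w \<in> B" using * w by blast
      moreover have "\<forall>x\<in>B. \<forall>y\<in>A. \<not> R x y" using * R(1) by (meson sympD)
      ultimately show ?thesis using that[of B A] * by blast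
    qed
  qed
  \<comment> \<open>The non-neighbours of \<open>v\<close> in \<open>A\<close>. The set contains
    \<open>w\<close> and omits \<open>v\<close>, so a connected \<open>V\<close> has an edge leaving
    it.\<close>
  define C where "C = {x \<in> A. \<not> R v x}"
  have sub: "C \<subseteq> V" "v \<notin> C" "B \<subseteq> V" "v \<notin> B" and wC: "w \<in> C"
    using AB w unfolding C_def by auto
  show ?thesis
  proof (rule ccontr)
    assume "\<not> ?thesis"
    then have conn: "\<not> disconnected R V" by blast
    have "\<exists>x\<in>C. \<exists>y\<in>V - C. R x y"
    proof (rule ccontr)
      assume "\<not> ?thesis"
      then have "disconnected R V"
        unfolding disconnected_def using AB(4) sub w v wC
        by (intro exI[of _ C] exI[of _ "V - C"]) auto
      with conn show False ..
    qed
    then obtain x y where xy: "x \<in> C" "y \<in> V - C" "R x y" by blast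
    have "\<exists>z\<in>B. \<exists>u\<in>V - B. R z u"
    proof (rule ccontr)
      assume "\<not> ?thesis"
      then have "disconnected R V"
        unfolding disconnected_def using AB(3) sub v
        by (intro exI[of _ B] exI[of _ "V - B"]) auto
      with conn show False ..
    qed
    then obtain z u where zu: "z \<in> B" "u \<in> V - B" "R z u" by blast
    \<comment> \<open>\<open>B\<close> has no edges to \<open>A\<close>, so an edge leaving
      \<open>B\<close> can only end in \<open>v\<close>.\<close>
    have "u = v" using zu AB R(1) by (metis DiffE DiffI UnE empty_iff insertE sympD)
    then have zv: "R v z" using zu R(1) by (meson sympD)
    \<comment> \<open>An edge leaving \<open>C\<close> ends neither in \<open>v\<close> nor in
      \<open>B\<close>, hence in a neighbour \<open>y\<close> of \<open>v\<close> inside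
      \<open>A\<close>; then \<open>x, y, v, z\<close> is the forbidden path.\<close>
    have yv: "y \<noteq> v" using xy C_def R(1) by (metis (no_types, lifting) mem_Collect_eq sympD)
    then have yA: "y \<in> A" using xy AB C_def by blast
    then have vy: "R v y" using xy C_def by blast
    have dist: "distinct [x, y, v, z]"
      using xy yA yv zu AB C_def vy by auto
    have "R x y \<and> R y v \<and> R v z \<and> \<not> R x v \<and> \<not> R x z \<and> \<not> R y z"
      using xy vy zv yA zu AB C_def R(1) by (metis (no_types, lifting) mem_Collect_eq sympD)
    moreover have "x \<in> V" "y \<in> V" "v \<in> V" "z \<in> V"
      using xy C_def AB zu v by auto
    ultimately show False
      using R(2) dist unfolding P4_free_def by blast
  qed
qed

text \<open>Seinsche's theorem. A vertex is deleted, the induction hypothesis is applied to the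
  rest, and the vertex is put back by \<open>disconnected_insert\<close>, used for \<open>R\<close>
  or for its complement.\<close>

lemma P4_free_disconnected:
  assumes "finite V" "symp R" "P4_free R V" "2 \<le> card V"
  shows "disconnected R V \<or> disconnected (\<lambda>x y. \<not> R x y) V"
  using assms
proof (induction "card V" arbitrary: V rule: less_induct)
  case less
  obtain v where v: "v \<in> V" using less.prems by fastforce
  define W where "W = V - {v}"
  have cW: "card W = card V - 1" "W \<noteq> {}" "finite W"
    using v less.prems unfolding W_def by (auto simp: subset_singleton_iff)
  have comp: "symp (\<lambda>x y. \<not> R x y)" using less.prems(2) by (auto simp: symp_def)
  show ?case
  proof (cases "card W = 1")
    case True
    then obtain w where w: "W = {w}" by (metis card_1_singletonE)
    have V: "V = {v, w}" "v \<noteq> w" using w v unfolding W_def by auto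
    show ?thesis
    proof (cases "R v w")
      case True
      then have "disconnected (\<lambda>x y. \<not> R x y) V"
        unfolding disconnected_def using V by (intro exI[of _ "{v}"] exI[of _ "{w}"]) auto
      then show ?thesis ..
    next
      case False
      then have "disconnected R V"
        unfolding disconnected_def using V by (intro exI[of _ "{v}"] exI[of _ "{w}"]) auto
      then show ?thesis ..
    qed
  next
    case False
    then have "disconnected R W \<or> disconnected (\<lambda>x y. \<not> R x y) W"
      using cW less.prems less.hyps[of W] P4_free_subset[of R V W] v W_def by fastforce
    then show ?thesis
    proof
      assume "disconnected R W"
      then show ?thesis
        using disconnected_insert[of R V v] less.prems v W_def by blast
    next
      \<comment> \<open>Here the complement plays the role of \<open>R\<close>, and its own
        complement is \<open>R\<close> again.\<close>
      assume "disconnected (\<lambda>x y. \<not> R x y) W"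
      then show ?thesis
        using disconnected_insert[OF comp P4_free_complement[OF less.prems(2,3)] v] W_def by auto
    qed
  qed
qed

section \<open>Adjacency in a cograph\<close>

text \<open>The conjunct \<open>x \<noteq> y\<close> makes the relation irreflexive for every
  \<open>E\<close>, even one that contains singletons.\<close>

definition adjacent :: "'a set set \<Rightarrow> 'a \<Rightarrow> 'a \<Rightarrow> bool" where
  "adjacent E x y \<longleftrightarrow> x \<noteq> y \<and> {x, y} \<in> E"

lemma symp_adjacent: "symp (adjacent E)"
  by (auto simp: symp_def adjacent_def insert_commute)

lemma cograph_P4_free:
  assumes "cograph V E"
  shows "P4_free (adjacent E) V"
  unfolding P4_free_def
proof (intro ballI impI notI)
  fix a b c d
  assume m: "a \<in> V" "b \<in> V" "c \<in> V" "d \<in> V" and dist: "distinct [a, b, c, d]"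
    and p: "adjacent E a b \<and> adjacent E b c \<and> adjacent E c d \<and>
      \<not> adjacent E a c \<and> \<not> adjacent E a d \<and> \<not> adjacent E b d"
  \<comment> \<open>The isomorphism condition also ranges over \<open>u = v\<close>, where
    \<open>{u, v}\<close> is a singleton.\<close>
  have loop: "{x} \<notin> E" for x
    using assms unfolding cograph_def fin_graph_def nsets_def by auto
  define f where "f = (\<lambda>x. if x = a then 0 else if x = b then 1 else if x = c then 2 else 3 :: nat)"
  let ?S = "{a, b, c, d}"
  have f: "f a = 0" "f b = 1" "f c = 2" "f d = 3"
    using dist by (auto simp: f_def)
  have e: "{a, b} \<in> E" "{b, a} \<in> E" "{b, c} \<in> E" "{c, b} \<in> E" "{c, d} \<in> E" "{d, c} \<in> E"
    "{a, c} \<notin> E" "{c, a} \<notin> E" "{a, d} \<notin> E" "{d, a} \<notin> E" "{b, d} \<notin> E" "{d, b} \<notin> E"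
    using p dist by (auto simp: adjacent_def insert_commute)
  have "bij_betw f ?S P4_verts"
    unfolding bij_betw_def inj_on_def P4_verts_def using f by auto
  moreover have "\<forall>u\<in>?S. \<forall>v\<in>?S. {u, v} \<in> induced_edges E ?S \<longleftrightarrow> {f u, f v} \<in> P4_edges"
    using f e loop by (auto simp: induced_edges_def P4_edges_def doubleton_eq_iff)
  ultimately have "graph_iso ?S (induced_edges E ?S) P4_verts P4_edges"
    unfolding graph_iso_def by blast
  moreover have "?S \<subseteq> V" using m by blast
  ultimately show False using assms unfolding cograph_def by blast
qed

section \<open>Multisets of part sizes\<close>

text \<open>Compared by the multiset order, which on \<open>nat\<close> is total and agrees with the
  lexicographic comparison of the non-increasing lists; a common element can be added or
  cancelled.\<close>

definition part_sizes :: "'a set set \<Rightarrow> nat multiset" where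
  "part_sizes F = image_mset card (mset_set F)"

lemma part_sizes_empty [simp]: "part_sizes {} = {#}"
  by (simp add: part_sizes_def)

lemma part_sizes_insert:
  "finite F \<Longrightarrow> X \<notin> F \<Longrightarrow> part_sizes (insert X F) = add_mset (card X) (part_sizes F)"
  by (simp add: part_sizes_def)

lemma part_sizes_remove:
  "finite F \<Longrightarrow> X \<in> F \<Longrightarrow> part_sizes F = add_mset (card X) (part_sizes (F - {X}))"
  by (metis Diff_iff finite_Diff insertI1 insert_Diff part_sizes_insert)

lemma part_sizes_Un:
  "finite F \<Longrightarrow> finite H \<Longrightarrow> F \<inter> H = {} \<Longrightarrow> part_sizes (F \<union> H) = part_sizes F + part_sizes H"
  by (simp add: part_sizes_def mset_set_Union)

lemma in_part_sizes: "finite F \<Longrightarrow> m \<in># part_sizes F \<longleftrightarrow> (\<exists>X\<in>F. m = card X)"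
  by (auto simp: part_sizes_def)

text \<open>An element of \<open>M\<close> above all of \<open>N\<close> would by itself make
  \<open>M\<close> the larger multiset.\<close>

lemma le_multiset_bound:
  fixes M N :: "'a::linorder multiset"
  assumes "M \<le> N" "\<forall>n\<in>#N. n \<le> k" "m \<in># M"
  shows "m \<le> k"
proof (rule ccontr)
  assume "\<not> m \<le> k"
  then have "N < M" using assms by (intro ex_gt_imp_less_multiset) force
  then show False using assms(1) by simp
qed

section \<open>Partitions under removal, union and restriction\<close>

text \<open>The case \<open>X = {}\<close> changes nothing, because a partition has no empty part;
  it covers the exhausted side in \<open>join_families\<close>.\<close>

lemma partition_on_remove: "partition_on A P \<Longrightarrow> X \<in> P \<or> X = {} \<Longrightarrow> partition_on (A - X) (P - {X})"
  by (auto simp: partition_on_def pairwise_def disjnt_def)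

lemma partition_on_Un:
  assumes "partition_on A P" "partition_on B Q" "A \<inter> B = {}"
  shows "partition_on (A \<union> B) (P \<union> Q)"
proof (rule partition_onI)
  have U: "\<Union>P = A" "\<Union>Q = B" using assms by (auto dest: partition_onD1)
  then show "\<Union>(P \<union> Q) = A \<union> B" by simp
  show "{} \<notin> P \<union> Q" using assms by (auto dest: partition_onD3)
  fix p q assume pq: "p \<in> P \<union> Q" "q \<in> P \<union> Q" "p \<noteq> q"
  have same: "p \<in> R \<Longrightarrow> q \<in> R \<Longrightarrow> disjnt p q" if "disjoint R" for R
    using that pq(3) by (simp add: pairwise_def disjnt_def)
  have "disjnt p q" if "p \<subseteq> A \<and> q \<subseteq> B \<or> p \<subseteq> B \<and> q \<subseteq> A"
    using that assms(3) unfolding disjnt_def by blast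
  then show "disjnt p q"
    using pq same[OF partition_onD2[OF assms(1)]] same[OF partition_onD2[OF assms(2)]] U by blast
qed

text \<open>Nonempty traces of different parts are disjoint, hence different, so no two of them are
  merged in the image; the parts that miss \<open>A\<close> give the zeros discarded by the
  filter.\<close>

lemma partition_on_restrict_sizes:
  assumes "partition_on V Q" "finite V" "A \<subseteq> V"
  defines "QA \<equiv> (\<inter>) A ` Q - {{}}"
  shows "partition_on A QA"
    and "part_sizes QA = filter_mset (\<lambda>m. m > 0) (image_mset (\<lambda>Y. card (Y \<inter> A)) (mset_set Q))"
proof -
  show "partition_on A QA"
    using partition_on_restrict[OF assms(1), of A] assms(3) unfolding QA_def by (simp add: Int_absorb2)
  have finQ: "finite Q" using assms finite_elements by blast
  let ?P = "{Y \<in> Q. Y \<inter> A \<noteq> {}}"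
  have inj: "inj_on ((\<inter>) A) ?P"
    using assms(1) unfolding partition_on_def inj_on_def pairwise_def disjnt_def by blast
  have QA: "QA = (\<inter>) A ` ?P" unfolding QA_def by auto
  have "part_sizes QA = image_mset (\<lambda>Y. card (Y \<inter> A)) (mset_set ?P)"
    unfolding part_sizes_def QA image_mset_mset_set[OF inj, symmetric]
    by (simp add: multiset.map_comp comp_def Int_commute)
  also have "mset_set ?P = filter_mset (\<lambda>Y. card (Y \<inter> A) > 0) (mset_set Q)"
  proof -
    have "finite (Y \<inter> A)" for Y using assms finite_subset by blast
    then show ?thesis
      using finQ by (simp add: filter_mset_mset_set card_gt_0_iff)
  qed
  finally show "part_sizes QA = filter_mset (\<lambda>m. m > 0) (image_mset (\<lambda>Y. card (Y \<inter> A)) (mset_set Q))"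
    by (simp add: filter_mset_image_mset)
qed

text \<open>
  \<open>D\<close> lists, for each clique of a partition of a join, the sizes of its traces on the two sides.
  A largest part is put to be \<open>{}\<close> when the family is exhausted, so that one induction
  covers families with different numbers of parts.
\<close>

lemma join_families:
  fixes D :: "(nat \<times> nat) multiset"
  assumes "partition_on U1 F1" "partition_on U2 F2" "finite U1" "finite U2" "U1 \<inter> U2 = {}"
    and "filter_mset (\<lambda>m. m > 0) (image_mset fst D) \<le> part_sizes F1"
    and "filter_mset (\<lambda>m. m > 0) (image_mset snd D) \<le> part_sizes F2"
    and "X1 \<in> F1 \<or> F1 = {} \<and> X1 = {}" "\<forall>Y\<in>F1. card Y \<le> card X1"
    and "X2 \<in> F2 \<or> F2 = {} \<and> X2 = {}" "\<forall>Y\<in>F2. card Y \<le> card X2"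
  shows "\<exists>R. partition_on (U1 \<union> U2) R \<and> (F1 \<union> F2 \<noteq> {} \<longrightarrow> X1 \<union> X2 \<in> R) \<and>
    (\<forall>Z\<in>R. \<exists>Z1\<in>insert {} F1. \<exists>Z2\<in>insert {} F2. Z = Z1 \<union> Z2) \<and>
    filter_mset (\<lambda>m. m > 0) (image_mset (\<lambda>(a, b). a + b) D) \<le> part_sizes R"
  using assms
proof (induction "card F1 + card F2" arbitrary: U1 F1 U2 F2 D X1 X2 rule: less_induct)
  case less
  note p1 = less.prems(1) and p2 = less.prems(2) and fU1 = less.prems(3) and fU2 = less.prems(4)
    and dis = less.prems(5) and D1 = less.prems(6) and D2 = less.prems(7)
    and X1 = less.prems(8,9) and X2 = less.prems(10,11)
  have fin: "finite F1" "finite F2" using p1 p2 fU1 fU2 finite_elements by blast+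
  have ne: "{} \<notin> F1" "{} \<notin> F2" using p1 p2 by (auto dest: partition_onD3)
  have U: "U1 = \<Union>F1" "U2 = \<Union>F2" using p1 p2 by (auto dest: partition_onD1)
  have sub: "X1 \<subseteq> U1" "X2 \<subseteq> U2" using X1 X2 U by auto
  have fX: "finite X1" "finite X2" using sub fU1 fU2 finite_subset by blast+
  have cX: "card (X1 \<union> X2) = card X1 + card X2"
    using fX sub dis by (intro card_Un_disjoint) auto
  \<comment> \<open>The sizes in \<open>F1\<close> are at most \<open>card X1\<close>, and the
    multiset inequality carries this bound over to the first coordinates in \<open>D\<close>. A zero
    is absent from the filtered multiset but is bounded trivially.\<close>
  have b1: "a \<le> card X1" if "(a, b) \<in># D" for a b
  proof (cases "a = 0")
    case False
    then have "a \<in># filter_mset (\<lambda>m. m > 0) (image_mset fst D)" using that by force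
    moreover have "\<forall>n\<in>#part_sizes F1. n \<le> card X1" using X1(2) fin by (auto simp: in_part_sizes)
    ultimately show ?thesis using le_multiset_bound[OF D1] by blast
  qed simp
  have b2: "b \<le> card X2" if "(a, b) \<in># D" for a b
  proof (cases "b = 0")
    case False
    then have "b \<in># filter_mset (\<lambda>m. m > 0) (image_mset snd D)" using that by force
    moreover have "\<forall>n\<in>#part_sizes F2. n \<le> card X2" using X2(2) fin by (auto simp: in_part_sizes)
    ultimately show ?thesis using le_multiset_bound[OF D2] by blast
  qed simp
  show ?case
  proof (cases "F1 \<union> F2 = {}")
    case True
    then have "X1 = {}" "X2 = {}" using X1 X2 by auto
    then have "\<forall>(a, b) \<in># D. a + b = 0" using b1 b2 by fastforce
    then have "filter_mset (\<lambda>m. m > 0) (image_mset (\<lambda>(a, b). a + b) D) = {#}"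
      by (auto simp flip: set_mset_eq_empty_iff)
    then have "filter_mset (\<lambda>m. m > 0) (image_mset (\<lambda>(a, b). a + b) D) \<le> part_sizes {}"
      by (simp only: less_eq_multiset_empty_left)
    moreover have "partition_on (U1 \<union> U2) {}" using True U by (auto simp: partition_on_def)
    ultimately show ?thesis using True by blast
  next
    case False
    define G1 G2 where "G1 = F1 - {X1}" and "G2 = F2 - {X2}"
    have finG: "finite G1" "finite G2" using fin by (auto simp: G1_def G2_def)
    have q1: "partition_on (U1 - X1) G1" unfolding G1_def
      by (rule partition_on_remove[OF p1]) (use X1 in auto)
    have q2: "partition_on (U2 - X2) G2" unfolding G2_def
      by (rule partition_on_remove[OF p2]) (use X2 in auto)
    have Xne: "X1 \<union> X2 \<noteq> {}" using False X1 X2 ne by auto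
    have Xpos: "card (X1 \<union> X2) > 0" using Xne fX by (simp add: card_gt_0_iff)
    have UX: "U1 \<union> U2 - (X1 \<union> X2) = (U1 - X1) \<union> (U2 - X2)" using sub dis by blast
    have insertX: "partition_on (U1 \<union> U2) (insert (X1 \<union> X2) R)" "finite R"
      "part_sizes (insert (X1 \<union> X2) R) = add_mset (card X1 + card X2) (part_sizes R)"
      if R: "partition_on ((U1 - X1) \<union> (U2 - X2)) R" for R
    proof -
      have UR: "\<Union>R = (U1 - X1) \<union> (U2 - X2)" using R by (auto dest: partition_onD1)
      have dj: "disjnt (X1 \<union> X2) (\<Union>R)" unfolding UR disjnt_def using sub dis by blast
      show "partition_on (U1 \<union> U2) (insert (X1 \<union> X2) R)"
        unfolding partition_on_insert[OF dj] UX using R sub Xne by blast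
      show "finite R" using finite_elements[OF _ R] fU1 fU2 by simp
      moreover have "X1 \<union> X2 \<notin> R" using dj Xne by (auto simp: disjnt_def)
      ultimately show "part_sizes (insert (X1 \<union> X2) R) = add_mset (card X1 + card X2) (part_sizes R)"
        by (simp add: part_sizes_insert cX)
    qed
    \<comment> \<open>Both cases below end alike: \<open>X1 \<union> X2\<close> is added to a family
      \<open>R\<close> on the remaining vertices.\<close>
    have goalI: ?thesis
      if R: "partition_on ((U1 - X1) \<union> (U2 - X2)) R"
        and dec: "\<And>Z. Z \<in> R \<Longrightarrow> \<exists>Z1\<in>insert {} G1. \<exists>Z2\<in>insert {} G2. Z = Z1 \<union> Z2"
        and le: "filter_mset (\<lambda>m. m > 0) (image_mset (\<lambda>(a, b). a + b) D)
          \<le> add_mset (card X1 + card X2) (part_sizes R)" for R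
    proof (intro exI conjI ballI impI)
      show "partition_on (U1 \<union> U2) (insert (X1 \<union> X2) R)" by (rule insertX(1)[OF R])
      show "filter_mset (\<lambda>m. m > 0) (image_mset (\<lambda>(a, b). a + b) D)
        \<le> part_sizes (insert (X1 \<union> X2) R)"
        unfolding insertX(3)[OF R] by (rule le)
      fix Z assume "Z \<in> insert (X1 \<union> X2) R"
      then show "\<exists>Z1\<in>insert {} F1. \<exists>Z2\<in>insert {} F2. Z = Z1 \<union> Z2"
      proof
        assume "Z = X1 \<union> X2"
        moreover have "X1 \<in> insert {} F1" "X2 \<in> insert {} F2" using X1 X2 by auto
        ultimately show ?thesis by blast
      next
        assume "Z \<in> R"
        then obtain Z1 Z2 where "Z1 \<in> insert {} G1" "Z2 \<in> insert {} G2" "Z = Z1 \<union> Z2"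
          using dec by blast
        moreover from this have "Z1 \<in> insert {} F1" "Z2 \<in> insert {} F2"
          by (auto simp: G1_def G2_def)
        ultimately show ?thesis by blast
      qed
    qed simp
    show ?thesis
    proof (cases "(card X1, card X2) \<in># D")
      case False
      \<comment> \<open>If no pair attains both maxima, every sum is below
        \<open>card X1 + card X2\<close>. This one size then beats the whole multiset, so all other
        parts may stay unpaired.\<close>
      have lt: "a + b < card X1 + card X2" if "(a, b) \<in># D" for a b
      proof -
        have "a \<noteq> card X1 \<or> b \<noteq> card X2" using that False by blast
        then show ?thesis using b1[OF that] b2[OF that] by linarith
      qed
      let ?R = "G1 \<union> G2"
      have R: "partition_on ((U1 - X1) \<union> (U2 - X2)) ?R"
        by (rule partition_on_Un[OF q1 q2]) (use dis in blast)
      have "filter_mset (\<lambda>m. m > 0) (image_mset (\<lambda>(a, b). a + b) D)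
          < add_mset (card X1 + card X2) (part_sizes ?R)"
        using lt by (intro ex_gt_imp_less_multiset exI[of _ "card X1 + card X2"]) auto
      moreover have "\<exists>Z1\<in>insert {} G1. \<exists>Z2\<in>insert {} G2. Z = Z1 \<union> Z2" if "Z \<in> ?R" for Z
        using that by auto
      ultimately show ?thesis using goalI[OF R] by simp
    next
      case True
      then obtain D' where D': "D = add_mset (card X1, card X2) D'" by (meson mset_add)
      \<comment> \<open>The same positive size is cancelled on both sides; if \<open>F1\<close> is
        exhausted, the removed coordinate is a zero, which the filter drops anyway.\<close>
      have E1: "filter_mset (\<lambda>m. m > 0) (image_mset fst D') \<le> part_sizes G1"
      proof (cases "X1 \<in> F1")
        case True
        then have "card X1 > 0" using ne fX by (auto simp: card_gt_0_iff)
        then show ?thesis using D1 part_sizes_remove[OF fin(1) True] by (simp add: D' G1_def)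
      next
        case False
        then show ?thesis using D1 X1 by (simp add: D' G1_def)
      qed
      have E2: "filter_mset (\<lambda>m. m > 0) (image_mset snd D') \<le> part_sizes G2"
      proof (cases "X2 \<in> F2")
        case True
        then have "card X2 > 0" using ne fX by (auto simp: card_gt_0_iff)
        then show ?thesis using D2 part_sizes_remove[OF fin(2) True] by (simp add: D' G2_def)
      next
        case False
        then show ?thesis using D2 X2 by (simp add: D' G2_def)
      qed
      have ex_max: "\<exists>Y. (Y \<in> F \<or> F = {} \<and> Y = {}) \<and> (\<forall>Z\<in>F. card Z \<le> card Y)"
        if "finite F" for F :: "'a set set"
      proof (cases "F = {}")
        case False
        then have "Max (card ` F) \<in> card ` F" using that by simp
        then obtain Y where "Y \<in> F" "card Y = Max (card ` F)" by auto
        then show ?thesis using that by (intro exI[of _ Y]) auto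
      qed simp
      obtain Y1 where Y1: "Y1 \<in> G1 \<or> G1 = {} \<and> Y1 = {}" "\<forall>Z\<in>G1. card Z \<le> card Y1"
        using ex_max[OF finG(1)] by blast
      obtain Y2 where Y2: "Y2 \<in> G2 \<or> G2 = {} \<and> Y2 = {}" "\<forall>Z\<in>G2. card Z \<le> card Y2"
        using ex_max[OF finG(2)] by blast
      have "card G1 \<le> card F1" "card G2 \<le> card F2"
        unfolding G1_def G2_def using fin by (auto intro: card_mono)
      \<comment> \<open>One side may be exhausted, but not both, so the number of parts
        drops.\<close>
      moreover have "card G1 < card F1 \<or> card G2 < card F2"
        unfolding G1_def G2_def using fin False X1 X2 by (auto intro: card_Diff1_less)
      ultimately have less': "card G1 + card G2 < card F1 + card F2" by linarith
      obtain R where R: "partition_on ((U1 - X1) \<union> (U2 - X2)) R"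
        "\<forall>Z\<in>R. \<exists>Z1\<in>insert {} G1. \<exists>Z2\<in>insert {} G2. Z = Z1 \<union> Z2"
        "filter_mset (\<lambda>m. m > 0) (image_mset (\<lambda>(a, b). a + b) D') \<le> part_sizes R"
        using less.hyps[OF less' q1 q2 _ _ _ E1 E2 Y1 Y2] fU1 fU2 dis by blast
      have "filter_mset (\<lambda>m. m > 0) (image_mset (\<lambda>(a, b). a + b) D)
          \<le> add_mset (card X1 + card X2) (part_sizes R)"
        unfolding D' using R(3) Xpos cX by simp
      then show ?thesis using goalI[OF R(1)] R(2) by simp
    qed
  qed
qed

section \<open>Exchanging a maximum clique\<close>

lemma clique_partition_Un:
  "clique_partition A E P \<Longrightarrow> clique_partition B E Q \<Longrightarrow> A \<inter> B = {} \<Longrightarrow>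
   clique_partition (A \<union> B) E (P \<union> Q)"
  unfolding clique_partition_def using partition_on_Un by blast

lemma clique_partition_restrict:
  "clique_partition V E Q \<Longrightarrow> A \<subseteq> V \<Longrightarrow> clique_partition A E ((\<inter>) A ` Q - {{}})"
  using partition_on_restrict[of V Q A]
  by (auto simp: clique_partition_def Int_absorb2 intro: smaller_clique)

lemma maximum_clique_nonempty:
  assumes "maximum_clique V E X" "V \<noteq> {}"
  shows "X \<noteq> {}"
proof -
  obtain v where "v \<in> V" using assms by auto
  then have "card {v} \<le> card X"
    using assms(1) unfolding maximum_clique_def by (auto simp: clique_def)
  then show ?thesis by auto
qed

text \<open>This lets a partition of largest size multiset start with the greedy choice
  \<open>X\<close>. It fails for empty \<open>V\<close>, where \<open>{}\<close> is a maximum clique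
  but never a part.\<close>

definition exchangeable :: "'a set \<Rightarrow> 'a set set \<Rightarrow> bool" where
  "exchangeable V E \<longleftrightarrow> (\<forall>Q X. clique_partition V E Q \<and> maximum_clique V E X \<longrightarrow>
     (\<exists>Q'. clique_partition V E Q' \<and> X \<in> Q' \<and> part_sizes Q \<le> part_sizes Q'))"

lemma exchangeableE:
  assumes "exchangeable V E" "clique_partition V E Q" "maximum_clique V E X"
  obtains Q' where "clique_partition V E Q'" "X \<in> Q'" "part_sizes Q \<le> part_sizes Q'"
  using assms unfolding exchangeable_def by blast

lemma clique_in_union:
  assumes "clique Y E" "Y \<subseteq> A \<union> B" "A \<inter> B = {}" "\<forall>x\<in>A. \<forall>y\<in>B. \<not> adjacent E x y"
  shows "Y \<subseteq> A \<or> Y \<subseteq> B"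
proof (rule ccontr)
  assume "\<not> ?thesis"
  then obtain x y where "x \<in> Y" "x \<in> A" "y \<in> Y" "y \<in> B" "x \<noteq> y" using assms by blast
  then show False using assms unfolding clique_def adjacent_def by blast
qed

text \<open>No clique meets both sides, so \<open>Q\<close> splits into partitions of
  \<open>A\<close> and of \<open>B\<close>. The one on the side of \<open>X\<close> is exchanged;
  the other contributes the same sizes before and after.\<close>

lemma exchange_union:
  assumes fin: "finite A" "finite B" and AB: "A \<inter> B = {}"
    and nonadj: "\<forall>x\<in>A. \<forall>y\<in>B. \<not> adjacent E x y"
    and ex: "exchangeable A E"
    and Q: "clique_partition (A \<union> B) E Q" and X: "maximum_clique (A \<union> B) E X" "X \<subseteq> A"
  shows "\<exists>Q'. clique_partition (A \<union> B) E Q' \<and> X \<in> Q' \<and> part_sizes Q \<le> part_sizes Q'"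
proof -
  define QA QB where "QA = {Y \<in> Q. Y \<subseteq> A}" and "QB = {Y \<in> Q. Y \<subseteq> B}"
  have Qp: "\<Union>Q = A \<union> B" "{} \<notin> Q" "disjoint Q" "\<forall>Y\<in>Q. clique Y E"
    using Q by (auto simp: clique_partition_def partition_on_def)
  have split: "Y \<subseteq> A \<or> Y \<subseteq> B" if "Y \<in> Q" for Y
    using clique_in_union[OF _ _ AB nonadj, of Y] Qp that by blast
  have QAB: "Q = QA \<union> QB" using split by (auto simp: QA_def QB_def)
  have "\<Union>QA \<subseteq> A" "\<Union>QB \<subseteq> B" by (auto simp: QA_def QB_def)
  moreover have "\<Union>QA \<union> \<Union>QB = A \<union> B" using Qp(1) QAB by simp
  ultimately have UA: "\<Union>QA = A" "\<Union>QB = B" using AB by blast+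
  have pA: "clique_partition A E QA" "clique_partition B E QB"
    using UA Qp unfolding clique_partition_def partition_on_def
    by (auto simp: QA_def QB_def pairwise_def)
  have XA: "maximum_clique A E X" using X unfolding maximum_clique_def by blast
  obtain QA' where QA': "clique_partition A E QA'" "X \<in> QA'" "part_sizes QA \<le> part_sizes QA'"
    using exchangeableE[OF ex pA(1) XA] by blast
  have ps: "part_sizes (P \<union> QB) = part_sizes P + part_sizes QB" if "clique_partition A E P" for P
  proof (rule part_sizes_Un)
    show "finite P" "finite QB"
      using that pA fin finite_elements unfolding clique_partition_def by blast+
    have "\<Union>P = A" "{} \<notin> P"
      using that by (auto simp: clique_partition_def partition_on_def)
    then have "Y \<subseteq> A" "Y \<noteq> {}" if "Y \<in> P" for Y using that by auto
    moreover have "Y \<subseteq> B" if "Y \<in> QB" for Y using that by (simp add: QB_def)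
    ultimately show "P \<inter> QB = {}" using AB by (metis Int_greatest disjoint_iff subset_empty)
  qed
  have "part_sizes Q \<le> part_sizes (QA' \<union> QB)"
    unfolding QAB using ps[OF pA(1)] ps[OF QA'(1)] QA'(3) by simp
  then show ?thesis
    using clique_partition_Un[OF QA'(1) pA(2) AB] QA'(2) by blast
qed

text \<open>Cliques of the two sides unite to cliques, so \<open>X\<close> meets each side in a
  maximum clique. The traces of \<open>Q\<close> are exchanged on each side, and
  \<open>join_families\<close> recombines the results with \<open>X1\<close> paired to
  \<open>X2\<close>.\<close>

lemma exchange_join:
  assumes fin: "finite A" "finite B" and AB: "A \<inter> B = {}" "A \<noteq> {}" "B \<noteq> {}"
    and adj: "\<forall>x\<in>A. \<forall>y\<in>B. adjacent E x y"
    and ex: "exchangeable A E" "exchangeable B E"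
    and Q: "clique_partition (A \<union> B) E Q" and X: "maximum_clique (A \<union> B) E X"
  shows "\<exists>Q'. clique_partition (A \<union> B) E Q' \<and> X \<in> Q' \<and> part_sizes Q \<le> part_sizes Q'"
proof -
  have join: "clique (Y \<union> Z) E" if "clique Y E" "clique Z E" "Y \<subseteq> A" "Z \<subseteq> B" for Y Z
    using that adj by (intro clique_Un) (auto simp: adjacent_def)
  have card_join: "card (Y \<union> Z) = card Y + card Z" if "Y \<subseteq> A" "Z \<subseteq> B" for Y Z
    using that fin AB by (intro card_Un_disjoint) (auto intro: finite_subset)
  define X1 X2 where "X1 = X \<inter> A" and "X2 = X \<inter> B"
  have Xc: "clique X E" "X \<subseteq> A \<union> B"
    and Xmax: "\<And>Y. Y \<subseteq> A \<union> B \<Longrightarrow> clique Y E \<Longrightarrow> card Y \<le> card X"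
    using X unfolding maximum_clique_def by auto
  have X12: "X = X1 \<union> X2" "X1 \<subseteq> A" "X2 \<subseteq> B" using Xc by (auto simp: X1_def X2_def)
  have c12: "clique X1 E" "clique X2 E"
    using Xc(1) by (auto simp: X1_def X2_def intro: smaller_clique)
  have cX: "card X = card X1 + card X2" using X12 card_join by simp
  have m1: "maximum_clique A E X1"
    unfolding maximum_clique_def
  proof (intro conjI allI impI)
    fix Y assume Y: "Y \<subseteq> A \<and> clique Y E"
    \<comment> \<open>A clique of \<open>A\<close> larger than \<open>X1\<close> would together with
      \<open>X2\<close> form a clique larger than \<open>X\<close>.\<close>
    then have "card (Y \<union> X2) \<le> card X" using X12 c12 join by (intro Xmax) auto
    then show "card Y \<le> card X1" using card_join[of Y X2] Y X12(3) cX by simp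
  qed (use X12 c12 in auto)
  have m2: "maximum_clique B E X2"
    unfolding maximum_clique_def
  proof (intro conjI allI impI)
    fix Y assume Y: "Y \<subseteq> B \<and> clique Y E"
    then have "card (X1 \<union> Y) \<le> card X" using X12 c12 join by (intro Xmax) auto
    then show "card Y \<le> card X2" using card_join[of X1 Y] Y X12(2) cX by simp
  qed (use X12 c12 in auto)
  have pQ: "partition_on (A \<union> B) Q" using Q by (simp add: clique_partition_def)
  obtain F1 where F1: "clique_partition A E F1" "X1 \<in> F1"
    "part_sizes ((\<inter>) A ` Q - {{}}) \<le> part_sizes F1"
    using exchangeableE[OF ex(1) clique_partition_restrict[OF Q] m1] by blast
  obtain F2 where F2: "clique_partition B E F2" "X2 \<in> F2"
    "part_sizes ((\<inter>) B ` Q - {{}}) \<le> part_sizes F2"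
    using exchangeableE[OF ex(2) clique_partition_restrict[OF Q] m2] by blast
  have p1: "partition_on A F1" "\<forall>Y\<in>F1. Y \<subseteq> A \<and> clique Y E"
    using F1(1) by (auto simp: clique_partition_def partition_on_def)
  have p2: "partition_on B F2" "\<forall>Y\<in>F2. Y \<subseteq> B \<and> clique Y E"
    using F2(1) by (auto simp: clique_partition_def partition_on_def)
  \<comment> \<open>Each part of \<open>Q\<close> is recorded by its two trace sizes: the
    coordinates give the sizes of the restricted partitions, the sums those of \<open>Q\<close>
    itself.\<close>
  define D where "D = image_mset (\<lambda>Y. (card (Y \<inter> A), card (Y \<inter> B))) (mset_set Q)"
  have D1: "filter_mset (\<lambda>m. m > 0) (image_mset fst D) \<le> part_sizes F1"
    using F1(3) partition_on_restrict_sizes(2)[OF pQ, of A] fin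
    by (simp add: D_def multiset.map_comp comp_def)
  have D2: "filter_mset (\<lambda>m. m > 0) (image_mset snd D) \<le> part_sizes F2"
    using F2(3) partition_on_restrict_sizes(2)[OF pQ, of B] fin
    by (simp add: D_def multiset.map_comp comp_def)
  have D: "filter_mset (\<lambda>m. m > 0) (image_mset (\<lambda>(a, b). a + b) D) = part_sizes Q"
  proof -
    have finQ: "finite Q" using pQ fin finite_elements by blast
    have QY: "card (Y \<inter> A) + card (Y \<inter> B) = card Y \<and> card Y > 0" if "Y \<in> Q" for Y
    proof -
      have Y: "Y \<subseteq> A \<union> B" "Y \<noteq> {}" using that pQ by (auto simp: partition_on_def)
      then have "Y = (Y \<inter> A) \<union> (Y \<inter> B)" by blast
      then show ?thesis
        using card_join[of "Y \<inter> A" "Y \<inter> B"] Y fin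
        by (metis Int_lower2 card_gt_0_iff finite_Un finite_subset)
    qed
    have "image_mset (\<lambda>(a, b). a + b) D = part_sizes Q"
      unfolding D_def part_sizes_def multiset.map_comp
      by (rule image_mset_cong) (use QY finQ in auto)
    moreover have "filter_mset (\<lambda>m. m > 0) (part_sizes Q) = part_sizes Q"
      using QY finQ by (auto simp: filter_mset_eq_conv in_part_sizes)
    ultimately show ?thesis by simp
  qed
  have max1: "\<forall>Y\<in>F1. card Y \<le> card X1" using m1 p1 unfolding maximum_clique_def by blast
  have max2: "\<forall>Y\<in>F2. card Y \<le> card X2" using m2 p2 unfolding maximum_clique_def by blast
  have "F1 \<union> F2 \<noteq> {}" using F1(2) by blast
  note families = join_families[OF p1(1) p2(1) fin AB(1) D1 D2
      disjI1[OF F1(2)] max1 disjI1[OF F2(2)] max2, unfolded D]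
  obtain R where "partition_on (A \<union> B) R \<and> (F1 \<union> F2 \<noteq> {} \<longrightarrow> X1 \<union> X2 \<in> R) \<and>
    (\<forall>Z\<in>R. \<exists>Z1\<in>insert {} F1. \<exists>Z2\<in>insert {} F2. Z = Z1 \<union> Z2) \<and> part_sizes Q \<le> part_sizes R"
    using families by (rule exE)
  then have R: "partition_on (A \<union> B) R" "X1 \<union> X2 \<in> R"
    "\<forall>Z\<in>R. \<exists>Z1\<in>insert {} F1. \<exists>Z2\<in>insert {} F2. Z = Z1 \<union> Z2" "part_sizes Q \<le> part_sizes R"
    using \<open>F1 \<union> F2 \<noteq> {}\<close> by iprover+
  have "clique Z E" if ZR: "Z \<in> R" for Z
  proof -
    obtain Z1 Z2 where Z: "Z1 \<in> insert {} F1" "Z2 \<in> insert {} F2" "Z = Z1 \<union> Z2"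
      using bspec[OF R(3) ZR] by blast
    have "clique Z1 E" "Z1 \<subseteq> A" "clique Z2 E" "Z2 \<subseteq> B" using Z(1,2) p1(2) p2(2) by auto
    then show ?thesis unfolding Z(3) by (intro join)
  qed
  then show ?thesis
    using R(1,2,4) unfolding clique_partition_def X12(1) by (intro exI[of _ R] conjI ballI)
qed

text \<open>Complete graphs, which include the single vertices, are handled directly; any other
  graph is split by \<open>P4_free_disconnected\<close> into a union or a join of smaller nonempty
  ones.\<close>

lemma P4_free_exchangeable:
  assumes "finite V" "V \<noteq> {}" "P4_free (adjacent E) V"
  shows "exchangeable V E"
  using assms
proof (induction "card V" arbitrary: V rule: less_induct)
  case less
  note fin = less.prems(1) and ne = less.prems(2) and free = less.prems(3)
  have smaller: "exchangeable A E" if "A \<union> B = V" "A \<inter> B = {}" "A \<noteq> {}" "B \<noteq> {}" for A B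
  proof (rule less.hyps)
    show "card A < card V" using that fin by (intro psubset_card_mono) auto
    show "finite A" using that fin by auto
    show "A \<noteq> {}" by (fact that)
    show "P4_free (adjacent E) A" using that free P4_free_subset by blast
  qed
  have "\<exists>Q'. clique_partition V E Q' \<and> X \<in> Q' \<and> part_sizes Q \<le> part_sizes Q'"
    if Q: "clique_partition V E Q" and X: "maximum_clique V E X" for Q X
  proof (cases "clique V E")
    case True
    have XV: "X = V"
      using X True fin unfolding maximum_clique_def by (metis card_seteq order_refl)
    show ?thesis
    proof (cases "V \<in> Q")
      case True
      then show ?thesis using Q XV by blast
    next
      case False
      have finQ: "finite Q" "\<Union>Q = V" "{} \<notin> Q"
        using Q fin finite_elements unfolding clique_partition_def partition_on_def by auto
      \<comment> \<open>Every part is a proper subset of \<open>V\<close>, so the single size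
        \<open>card V\<close> dominates the whole multiset.\<close>
      have "\<forall>Y\<in>Q. card Y < card V"
        using finQ False fin by (metis Union_upper psubsetI psubset_card_mono)
      then have "part_sizes Q \<le> part_sizes {V}"
        using finQ by (auto simp: part_sizes_insert in_part_sizes)
      moreover have "clique_partition V E {V}"
        using True ne by (simp add: clique_partition_def partition_on_space)
      ultimately show ?thesis using XV by blast
    qed
  next
    case False
    have "2 \<le> card V"
    proof (rule ccontr)
      assume "\<not> ?thesis"
      then have "card V = 0 \<or> card V = 1" by linarith
      then have "V = {} \<or> (\<exists>v. V = {v})" using fin by (auto simp: card_1_singleton_iff)
      then show False using False by (auto simp: clique_def)
    qed
    then consider "disconnected (adjacent E) V" | "disconnected (\<lambda>x y. \<not> adjacent E x y) V"
      using P4_free_disconnected[OF fin symp_adjacent free] by blast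
    then show ?thesis
    proof cases
      case 1
      then obtain A B where AB: "A \<union> B = V" "A \<inter> B = {}" "A \<noteq> {}" "B \<noteq> {}"
        "\<forall>x\<in>A. \<forall>y\<in>B. \<not> adjacent E x y"
        unfolding disconnected_def by blast
      \<comment> \<open>\<open>X\<close> may lie in either side, so the union case is also used with
        the sides swapped.\<close>
      have BA: "B \<union> A = V" "B \<inter> A = {}" "\<forall>x\<in>B. \<forall>y\<in>A. \<not> adjacent E x y"
        using AB symp_adjacent[of E] by (auto dest: sympD)
      have finAB: "finite A" "finite B" using AB fin by auto
      have "X \<subseteq> A \<or> X \<subseteq> B"
        using X AB by (intro clique_in_union) (auto simp: maximum_clique_def)
      then show ?thesis
        using exchange_union[OF finAB AB(2,5) smaller[OF AB(1-4)]]
          exchange_union[OF finAB(2,1) BA(2,3) smaller[OF BA(1,2) AB(4,3)]] Q X AB(1) BA(1) by metis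
    next
      case 2
      then obtain A B where AB: "A \<union> B = V" "A \<inter> B = {}" "A \<noteq> {}" "B \<noteq> {}"
        "\<forall>x\<in>A. \<forall>y\<in>B. adjacent E x y"
        unfolding disconnected_def by blast
      have BA: "B \<union> A = V" "B \<inter> A = {}" using AB by auto
      have finAB: "finite A" "finite B" using AB fin by auto
      show ?thesis
        using exchange_join[OF finAB AB(2-5) smaller[OF AB(1-4)] smaller[OF BA AB(4,3)]] Q X AB(1)
        by blast
    qed
  qed
  then show ?case unfolding exchangeable_def by blast
qed

section \<open>Greedy outputs\<close>

text \<open>The family \<open>A\<close> was collected before the current graph was reached, so the
  claim concerns the remainder \<open>P'\<close> of the output. The exchange property reduces the
  comparison to partitions that contain the first chosen clique.\<close>

lemma greedy_run_optimal:
  assumes "greedy_run V E A P" "finite V" "P4_free (adjacent E) V"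
  shows "\<exists>P'. P = A \<union> P' \<and> clique_partition V E P' \<and>
    (\<forall>Q. clique_partition V E Q \<longrightarrow> part_sizes Q \<le> part_sizes P')"
  using assms
proof (induction rule: greedy_run.induct)
  case (stop E A)
  then show ?case
    by (intro exI[of _ "{}"]) (auto simp: clique_partition_def partition_on_empty)
next
  case (step V E X A P)
  let ?W = "V - X"
  let ?E = "induced_edges E ?W"
  \<comment> \<open>Restricting the edges to \<open>?W\<close> keeps the cliques inside
    \<open>?W\<close>, so the induction hypothesis can be read with the original
    \<open>E\<close>.\<close>
  have cl: "clique Y ?E \<longleftrightarrow> clique Y E" if "Y \<subseteq> ?W" for Y
    using that unfolding clique_def induced_edges_def by blast
  have cp: "clique_partition ?W ?E R \<longleftrightarrow> clique_partition ?W E R" for R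
    using cl unfolding clique_partition_def partition_on_def by (metis Union_upper)
  have "P4_free (adjacent E) ?W" using step.prems P4_free_subset by blast
  moreover have "adjacent ?E x y \<longleftrightarrow> adjacent E x y" if "x \<in> ?W" "y \<in> ?W" for x y
    using that unfolding adjacent_def induced_edges_def by blast
  ultimately have "P4_free (adjacent ?E) ?W" unfolding P4_free_def by blast
  then obtain P' where P': "P = insert X A \<union> P'" "clique_partition ?W E P'"
    "\<And>Q. clique_partition ?W E Q \<Longrightarrow> part_sizes Q \<le> part_sizes P'"
    using step.IH step.prems cp by auto
  have X: "X \<noteq> {}" "X \<subseteq> V" "clique X E"
    using step.hyps maximum_clique_nonempty by (auto simp: maximum_clique_def)
  have UP': "\<Union>P' = ?W" "finite P'"
    using P'(2) step.prems(1) finite_elements unfolding clique_partition_def partition_on_def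
    by (auto simp: finite_UnionD)
  have new: "clique_partition V E (insert X P')"
    using P'(2) X partition_on_insert[of X P' V] UP' by (auto simp: clique_partition_def disjnt_def)
  have "X \<notin> P'" using UP' X by blast
  then have ps: "part_sizes (insert X P') = add_mset (card X) (part_sizes P')"
    using UP' by (simp add: part_sizes_insert)
  have "part_sizes Q \<le> part_sizes (insert X P')" if Q: "clique_partition V E Q" for Q
  proof -
    \<comment> \<open>After the exchange \<open>X\<close> is removed, the induction hypothesis
      compares the rest with \<open>P'\<close>, and adding \<open>card X\<close> on both sides
      preserves the order.\<close>
    obtain Q' where Q': "clique_partition V E Q'" "X \<in> Q'" "part_sizes Q \<le> part_sizes Q'"
      using exchangeableE[OF P4_free_exchangeable[OF step.prems(1) step.hyps(1) step.prems(2)] Q step.hyps(2)] by blast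
    have finQ': "finite Q'"
      using Q'(1) step.prems(1) finite_elements unfolding clique_partition_def by blast
    have "clique_partition ?W E (Q' - {X})"
      using Q' partition_on_remove[of V Q' X] by (auto simp: clique_partition_def)
    then have "part_sizes Q' \<le> part_sizes (insert X P')"
      using P'(3) ps part_sizes_remove[OF finQ' Q'(2)] by simp
    then show ?thesis using Q'(3) by (rule order_trans[rotated])
  qed
  then show ?case using new P'(1) by (intro exI[of _ "insert X P'"]) auto
qed

section \<open>Prefix sums and the multiset order\<close>

text \<open>At the first position where the lists differ, the prefix sums force the larger entry
  into \<open>ys\<close>, and it exceeds all remaining entries of the sorted \<open>xs\<close>. The
  equal entries before it cancel.\<close>

lemma mset_le_of_prefix_sums_le:
  fixes xs ys :: "nat list"
  assumes "sorted_wrt (\<ge>) xs" "\<forall>x\<in>set xs. x > 0"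
    and "\<And>j. sum_list (take j xs) \<le> sum_list (take j ys)"
  shows "mset xs \<le> mset ys"
  using assms
proof (induction xs arbitrary: ys)
  case (Cons x xs)
  note le = Cons.prems(3)
  \<comment> \<open>As \<open>x\<close> is positive, the prefix of length 1 rules out an empty
    \<open>ys\<close>.\<close>
  from le[of 1] Cons.prems(2) obtain y ys' where ys: "ys = y # ys'" by (cases ys) auto
  have xy: "x \<le> y" using le[of 1] ys by simp
  show ?case
  proof (cases "x = y")
    case True
    have "sum_list (take j xs) \<le> sum_list (take j ys')" for j
      using le[of "Suc j"] ys True by simp
    then have "mset xs \<le> mset ys'" using Cons.IH Cons.prems(1,2) by simp
    then show ?thesis using ys True by simp
  next
    case False
    then have "\<forall>z\<in>set (x # xs). z < y" using xy Cons.prems(1) by fastforce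
    then have "mset (x # xs) < mset ys"
      using ys by (intro ex_gt_imp_less_multiset) (auto intro!: exI[of _ y])
    then show ?thesis by simp
  qed
qed simp

lemma mset_sizes: "mset (sizes P) = part_sizes P"
  by (simp add: sizes_def part_sizes_def)

lemma length_sizes: "length (sizes P) = card P"
  by (metis mset_sizes part_sizes_def size_image_mset size_mset size_mset_set)

text \<open>The zero padding of \<open>part_size\<close> matches \<open>take\<close>, which returns
  the whole list once \<open>j\<close> passes its length.\<close>

lemma sum_part_size: "(\<Sum>i = 1..j. part_size P i) = sum_list (take j (sizes P))"
proof (induction j)
  case (Suc j)
  then show ?case
    by (cases "j < length (sizes P)")
      (simp_all add: take_Suc_conv_app_nth part_size_def length_sizes)
qed simp

lemma partition_le_iff: "P \<preceq> Q \<longleftrightarrow> (\<forall>j. sum_list (take j (sizes P)) \<le> sum_list (take j (sizes Q)))"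
proof
  assume le: "P \<preceq> Q"
  have *: "sum_list (take j (sizes P)) \<le> sum_list (take j (sizes Q))"
    if "j \<le> max (card P) (card Q)" for j
    using le that unfolding partition_le_def sum_part_size by (cases "j = 0") auto
  show "\<forall>j. sum_list (take j (sizes P)) \<le> sum_list (take j (sizes Q))"
  proof
    fix j
    show "sum_list (take j (sizes P)) \<le> sum_list (take j (sizes Q))"
      using *[of j] *[of "max (card P) (card Q)"]
      by (cases "j \<le> max (card P) (card Q)") (simp_all add: length_sizes)
  qed
qed (simp add: partition_le_def sum_part_size del: One_nat_def)

lemma partition_le_imp_part_sizes_le:
  assumes "P \<preceq> Q" "partition_on V P" "finite V"
  shows "part_sizes P \<le> part_sizes Q"
proof -
  have "finite P" using assms finite_elements by blast
  moreover have "card Y > 0" if "Y \<in> P" for Y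
  proof -
    have "Y \<subseteq> V" "Y \<noteq> {}" using that assms(2) by (auto simp: partition_on_def)
    then show ?thesis using assms(3) by (simp add: card_gt_0_iff finite_subset)
  qed
  ultimately have "\<forall>x\<in>#part_sizes P. x > 0" by (auto simp: in_part_sizes)
  then have "\<forall>x\<in>set (sizes P). x > 0" by (metis mset_sizes set_mset_mset)
  moreover have "sorted_wrt (\<ge>) (sizes P)" by (simp add: sizes_def sorted_wrt_rev)
  ultimately have "mset (sizes P) \<le> mset (sizes Q)"
    using assms(1) by (intro mset_le_of_prefix_sums_le) (auto simp: partition_le_iff)
  then show ?thesis by (simp add: mset_sizes)
qed

theorem theorem9:
  fixes V :: "'a set" and E :: "'a set set" and P :: "'a set set"
  assumes "cograph V E"
    and "greedy_output V E P"
  shows "clique_partition V E P \<and>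
    \<not> (\<exists>Q. clique_partition V E Q \<and> P \<preceq> Q \<and> \<not> Q \<preceq> P)"
proof -
  have fin: "finite V" using assms(1) by (simp add: cograph_def fin_graph_def)
  have P: "clique_partition V E P"
    and opt: "\<And>Q. clique_partition V E Q \<Longrightarrow> part_sizes Q \<le> part_sizes P"
    using greedy_run_optimal[of V E "{}" P] fin cograph_P4_free assms
    by (auto simp: greedy_output_def)
  have "Q \<preceq> P" if Q: "clique_partition V E Q" and le: "P \<preceq> Q" for Q
  proof -
    have "part_sizes P \<le> part_sizes Q"
      using partition_le_imp_part_sizes_le[OF le _ fin] P by (simp add: clique_partition_def)
    \<comment> \<open>Optimality of \<open>P\<close> gives the reverse inequality. Equal multisets
      have the same sorted list, so all prefix sums agree.\<close>
    then have "part_sizes P = part_sizes Q" using opt[OF Q] by simp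
    then have "sizes P = sizes Q" by (simp add: sizes_def part_sizes_def)
    then show ?thesis by (simp add: partition_le_iff)
  qed
  then show ?thesis using P by blast
qed

end
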